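(* For every integer $n \geq 1$, $\operatorname{diam}(\mathcal{R}_n) > n - \sqrt{2n}$.
   Context: A binary string is called run-constrained if every run (maximal block) of consecutive $1$s in it is immediately followed by a run of $0$s of strictly greater length. For $n \geq 1$, the Fibonacci-run graph $\mathcal{R}_n$ has vertex set $\{ w \in \{0,1\}^n : w00 \text{ is a run-constrained string of length } n+2\}$, and two vertices are adjacent iff they differ in exactly one coordinate. $\operatorname{diam}(G)$ is the maximum graph distance between two vertices of $G$. *)

theory Defs
  imports Complex_Main "Graph_Theory.Graph_Theory"
begin

text \<open>Binary strings are lists of booleans, with \<open>True\<close> for $1$ and \<open>False\<close> for $0$.\<close>

text \<open>The block of \<open>w\<close> occupying the positions \<open>i, \<dots>, i + k - 1\<close> is a run of \<open>b\<close>s,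
  i.e. a nonempty block of consecutive \<open>b\<close>s that is maximal on both sides.\<close>

definition is_run :: "bool \<Rightarrow> bool list \<Rightarrow> nat \<Rightarrow> nat \<Rightarrow> bool" where
  "is_run b w i k \<longleftrightarrow>
     0 < k \<and> i + k \<le> length w \<and> (\<forall>j. i \<le> j \<and> j < i + k \<longrightarrow> w ! j = b) \<and>
     (i = 0 \<or> w ! (i - 1) \<noteq> b) \<and> (i + k = length w \<or> w ! (i + k) \<noteq> b)"

definition run_constrained :: "bool list \<Rightarrow> bool" where
  "run_constrained w \<longleftrightarrow>
     (\<forall>i k. is_run True w i k \<longrightarrow> (\<exists>m. m > k \<and> is_run False w (i + k) m))"

definition fib_run_verts :: "nat \<Rightarrow> bool list set" where
  "fib_run_verts n = {w. length w = n \<and> run_constrained (w @ [False, False])}"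

text \<open>As usual in \<open>Graph_Theory\<close>, an undirected graph is a symmetric digraph.\<close>

definition fib_run_graph :: "nat \<Rightarrow> (bool list, bool list \<times> bool list) pre_digraph" where
  "fib_run_graph n =
     \<lparr> verts = fib_run_verts n,
       arcs = {(u, v). u \<in> fib_run_verts n \<and> v \<in> fib_run_verts n \<and> (\<exists>!i. i < n \<and> u ! i \<noteq> v ! i)},
       tail = fst,
       head = snd \<rparr>"

text \<open>The graph distance is the least cost of a walk when all arcs have cost 1. It is \<open>\<infinity>\<close> for
  vertices not joined by a walk; this does not occur in \<open>fib_run_graph n\<close>, see below.\<close>

definition graph_dist :: "('a, 'b) pre_digraph \<Rightarrow> 'a \<Rightarrow> 'a \<Rightarrow> ereal" where
  "graph_dist G u v = wf_digraph.\<mu> G (\<lambda>_. 1) u v"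

definition diam :: "('a, 'b) pre_digraph \<Rightarrow> ereal" where
  "diam G = (SUP (u, v) \<in> verts G \<times> verts G. graph_dist G u v)"

lemma diam_eq_Max:
  assumes "finite (verts G)" and "verts G \<noteq> {}"
  shows "diam G = Max ((\<lambda>(u, v). graph_dist G u v) ` (verts G \<times> verts G))"
  unfolding diam_def using assms by (subst Max_Sup) auto

lemma graph_fib_run_graph: "graph (fib_run_graph n)"
proof -
  have fin: "finite (fib_run_verts n)"
    by (rule finite_subset[OF _ finite_lists_length_eq[of "UNIV :: bool set" n]])
       (auto simp: fib_run_verts_def)
  have sub: "arcs (fib_run_graph n) \<subseteq> fib_run_verts n \<times> fib_run_verts n"
    by (auto simp: fib_run_graph_def)
  have fin': "finite (arcs (fib_run_graph n))"
    using finite_subset[OF sub] fin by blast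
  show ?thesis
    apply unfold_locales
    subgoal by (auto simp: fib_run_graph_def)
    subgoal by (auto simp: fib_run_graph_def)
    subgoal using fin by (simp add: fib_run_graph_def)
    subgoal by (rule fin')
    subgoal by (auto simp: fib_run_graph_def)
    subgoal by (auto simp: fib_run_graph_def arc_to_ends_def)
    subgoal
    proof -
      have "(\<exists>!i. i < n \<and> u ! i \<noteq> v ! i) \<longleftrightarrow> (\<exists>!i. i < n \<and> v ! i \<noteq> u ! i)" for u v :: "bool list"
        by (simp only: neq_commute)
      then have "sym (arcs (fib_run_graph n))"
        unfolding fib_run_graph_def sym_def by simp
      moreover have "arcs_ends (fib_run_graph n) = arcs (fib_run_graph n)"
        by (simp add: arcs_ends_conv fib_run_graph_def)
      ultimately show ?thesis by (simp add: symmetric_def)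
    qed
    done
qed

lemma is_runD:
  assumes "is_run b w i k"
  shows "0 < k" "i + k \<le> length w" "i \<le> j \<Longrightarrow> j < i + k \<Longrightarrow> w ! j = b"
    "i = 0 \<or> w ! (i - 1) \<noteq> b" "i + k = length w \<or> w ! (i + k) \<noteq> b"
  using assms by (auto simp: is_run_def)

lemma run_constrained_clear_last:
  assumes rc: "run_constrained x" and p: "p < length x" "x ! p"
    and last: "\<And>j. p < j \<Longrightarrow> j < length x \<Longrightarrow> \<not> x ! j"
    and suc: "Suc p < length x"
  shows "run_constrained (x[p := False])"
  unfolding run_constrained_def
proof (intro allI impI)
  let ?y = "x[p := False]"
  fix i k assume run: "is_run True ?y i k"
  note r = is_runD[OF run]
  have y: "?y ! j = (j \<noteq> p \<and> x ! j)" if "j < length x" for j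
    using that by (cases "j = p") auto
  have top1: "?y ! (i + k - 1)" using r(1) r(3)[of "i + k - 1"] by auto
  have bnd: "i + k - 1 < length x" using r(1,2) by (simp add: less_eq_Suc_le)
  have "i + k - 1 < p"
    using top1 y[OF bnd] last[OF _ bnd] by (metis linorder_neqE_nat)
  then have le: "i + k \<le> p" by simp
  have ones: "x ! j" if "i \<le> j" "j < i + k" for j
    using r(3)[OF that] y[of j] that le p(1) by auto
  have left: "i = 0 \<or> \<not> x ! (i - 1)"
    using r(4) y[of "i - 1"] le p(1) r(1) by auto
  show "\<exists>m>k. is_run False ?y (i + k) m"
  proof (cases "i + k = p")
    case True
    have "is_run True x i (k + 1)"
      unfolding is_run_def
    proof (intro conjI allI impI)
      fix j assume "i \<le> j \<and> j < i + (k + 1)"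
      then show "x ! j = True" using ones[of j] True p(2) by (cases "j = p") auto
    qed (use left True suc last[of "Suc p"] in auto)
    then obtain m where m: "m > k + 1" "is_run False x (i + (k + 1)) m"
      using rc unfolding run_constrained_def by blast
    have "is_run False ?y (i + k) (length x - (i + k))"
      unfolding is_run_def
    proof (intro conjI allI impI)
      fix j assume "i + k \<le> j \<and> j < i + k + (length x - (i + k))"
      then show "?y ! j = False" using y[of j] last[of j] True p(1) by (cases "j = p") auto
    qed (use top1 le p in auto)
    moreover have "length x - (i + k) > k" using m(1) is_runD(2)[OF m(2)] by auto
    ultimately show ?thesis by blast
  next
    case False
    then have lt: "i + k < p" using le by simp
    have end0: "\<not> x ! (i + k)" using r(5) y[of "i + k"] lt p(1) by auto
    have "is_run True x i k"
      unfolding is_run_def using r(1) ones left end0 lt p(1) by auto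
    then obtain m where m: "m > k" "is_run False x (i + k) m"
      using rc unfolding run_constrained_def by blast
    note s = is_runD[OF m(2)]
    have lem: "i + k + m \<le> p" using s(3)[of p] lt p(2) by (cases "i + k + m \<le> p") auto
    show ?thesis
    proof (cases "i + k + m = p")
      case True
      have "is_run False ?y (i + k) (length x - (i + k))"
        unfolding is_run_def
      proof (intro conjI allI impI)
        fix j assume "i + k \<le> j \<and> j < i + k + (length x - (i + k))"
        then show "?y ! j = False"
          using y[of j] last[of j] s(3)[of j] True p(1)
          by (cases j p rule: linorder_cases) auto
      qed (use top1 le p in auto)
      moreover have "length x - (i + k) > k" using True m(1) p(1) by auto
      ultimately show ?thesis by blast
    next
      case False
      then have lt': "i + k + m < p" using lem by simp
      have "is_run False ?y (i + k) m"
        unfolding is_run_def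
      proof (intro conjI allI impI)
        fix j assume "i + k \<le> j \<and> j < i + k + m"
        then show "?y ! j = False" using y[of j] s(3)[of j] lt' p(1) by auto
      next
        show "i + k = 0 \<or> ?y ! (i + k - 1) \<noteq> False"
          using top1 by simp
      next
        show "i + k + m = length ?y \<or> ?y ! (i + k + m) \<noteq> False"
          using s(5) y[of "i + k + m"] lt' p(1) by auto
      qed (use s(1,2) in auto)
      then show ?thesis using m(1) by blast
    qed
  qed
qed

lemma replicate_False_in_fib_run_verts: "replicate n False \<in> fib_run_verts n"
proof -
  have eq: "replicate n False @ [False, False] = replicate (n + 2) False"
    by (simp only: replicate_add) (simp add: numeral_2_eq_2)
  have "\<not> is_run True (replicate (n + 2) False) i k" for i k
  proof
    assume "is_run True (replicate (n + 2) False) i k"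
    note r = is_runD[OF this]
    have "i < n + 2" using r(1,2) by simp
    then have "replicate (n + 2) False ! i = False" by (rule nth_replicate)
    moreover have "replicate (n + 2) False ! i = True" using r(1) by (intro r(3)) auto
    ultimately show False by (rule False_neq_True[OF trans[OF sym]])
  qed
  then have "run_constrained (replicate n False @ [False, False])"
    unfolding eq run_constrained_def by blast
  then show ?thesis by (simp add: fib_run_verts_def)
qed

lemma fib_run_reachable_zero:
  assumes "w \<in> fib_run_verts n"
  shows "w \<rightarrow>\<^sup>*\<^bsub>fib_run_graph n\<^esub> replicate n False"
  using assms
proof (induction "card {i. i < n \<and> w ! i}" arbitrary: w rule: less_induct)
  case less
  interpret graph "fib_run_graph n" by (rule graph_fib_run_graph)
  have V: "verts (fib_run_graph n) = fib_run_verts n" by (simp add: fib_run_graph_def)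
  let ?S = "{i. i < n \<and> w ! i}"
  have len: "length w = n" and rc: "run_constrained (w @ [False, False])"
    using less.prems by (auto simp: fib_run_verts_def)
  show ?case
  proof (cases "?S = {}")
    case True
    then have "w = replicate n False" using len by (intro nth_equalityI) auto
    moreover have "w \<rightarrow>\<^sup>*\<^bsub>fib_run_graph n\<^esub> w"
      using less.prems V by (intro reachable_refl) simp
    ultimately show ?thesis by simp
  next
    case False
    define p where "p = Max ?S"
    have pS: "p \<in> ?S" unfolding p_def using False by (intro Max_in) auto
    have mx: "j \<le> p" if "j \<in> ?S" for j unfolding p_def using that by (intro Max_ge) auto
    let ?v = "w[p := False]"
    have "run_constrained ((w @ [False, False])[p := False])"
    proof (rule run_constrained_clear_last[OF rc])
      fix j assume "p < j" "j < length (w @ [False, False])"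
      then show "\<not> (w @ [False, False]) ! j"
        using mx[of j] len by (auto simp: nth_append nth_Cons split: nat.splits)
    qed (use pS len in \<open>auto simp: nth_append\<close>)
    then have vV: "?v \<in> fib_run_verts n"
      using pS len by (simp add: fib_run_verts_def list_update_append)
    have "?v ! i \<longleftrightarrow> w ! i \<and> i \<noteq> p" if "i < n" for i
      using that len by (cases "i = p") auto
    then have eq: "{i. i < n \<and> ?v ! i} = ?S - {p}" by blast
    have "card {i. i < n \<and> ?v ! i} < card ?S"
      unfolding eq by (rule card_Diff1_less[OF _ pS]) simp
    then have *: "?v \<rightarrow>\<^sup>*\<^bsub>fib_run_graph n\<^esub> replicate n False"
      using vV by (rule less.hyps)
    have "(w, ?v) \<in> arcs (fib_run_graph n)"
    proof -
      have "\<exists>!i. i < n \<and> w ! i \<noteq> ?v ! i"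
      proof (rule ex1I[of _ p])
        show "p < n \<and> w ! p \<noteq> ?v ! p" using pS len by simp
        show "i = p" if "i < n \<and> w ! i \<noteq> ?v ! i" for i
          using that by (cases "i = p") auto
      qed
      then show ?thesis using less.prems vV by (simp add: fib_run_graph_def)
    qed
    then have "w \<rightarrow>\<^bsub>fib_run_graph n\<^esub> ?v"
      by (intro dominatesI) (auto simp: arc_to_ends_def fib_run_graph_def)
    then show ?thesis using * by (rule adj_reachable_trans)
  qed
qed

lemma strongly_connected_fib_run_graph: "strongly_connected (fib_run_graph n)"
proof -
  interpret graph "fib_run_graph n" by (rule graph_fib_run_graph)
  have V: "verts (fib_run_graph n) = fib_run_verts n" by (simp add: fib_run_graph_def)
  show ?thesis
    unfolding strongly_connected_def V
  proof (intro conjI ballI)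
    show "fib_run_verts n \<noteq> {}" using replicate_False_in_fib_run_verts by blast
    fix u v assume "u \<in> fib_run_verts n" "v \<in> fib_run_verts n"
    then have "u \<rightarrow>\<^sup>*\<^bsub>fib_run_graph n\<^esub> replicate n False" "replicate n False \<rightarrow>\<^sup>*\<^bsub>fib_run_graph n\<^esub> v"
      by (simp_all add: fib_run_reachable_zero symmetric_reachable')
    then show "u \<rightarrow>\<^sup>*\<^bsub>fib_run_graph n\<^esub> v" by (rule reachable_trans)
  qed
qed

end

theory Submission
  imports Defs
begin

text \<open>Take two strings that are complementary on alternating blocks of lengths
  $1, 2, \dots, k$. Since block lengths increase, each run of ones is followed by a longer run of
  zeros in both strings. On the remaining $r$ positions, the string whose last block consists of
  ones continues with zeros, and the other one with $\lceil r/2\rceil$ ones followed by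
  $\lfloor r/2\rfloor$ zeros; the appended $00$ makes this admissible when $k \le r + 1$.
  The two strings agree in only $\lfloor r/2\rfloor$ positions. Every $n \ge 1$ is
  $k(k+1)/2 + r$ with $k - 1 \le r \le 2k$, so $\lfloor r/2\rfloor \le k < \sqrt{2n}$, and graph
  distance is at least Hamming distance.\<close>

section \<open>Building run-constrained strings from the back, block by block\<close>

text \<open>Since \<open>0 < i\<close>, the left neighbour of the block also lies in
  \<open>w\<close>, so maximality cannot depend on \<open>u\<close>.\<close>

lemma is_run_append:
  assumes "0 < i"
  shows "is_run b (u @ w) (length u + i) k \<longleftrightarrow> is_run b w i k"
proof -
  have "(\<forall>j. length u + i \<le> j \<and> j < length u + i + k \<longrightarrow> (u @ w) ! j = b) \<longleftrightarrow>
      (\<forall>j. i \<le> j \<and> j < i + k \<longrightarrow> w ! j = b)" (is "?L \<longleftrightarrow> ?R")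
  proof
    assume L: ?L
    show ?R
    proof (intro allI impI)
      fix j assume "i \<le> j \<and> j < i + k"
      then show "w ! j = b" using L[rule_format, of "length u + j"] by simp
    qed
  next
    assume R: ?R
    show ?L
    proof (intro allI impI)
      fix j assume j: "length u + i \<le> j \<and> j < length u + i + k"
      then have "w ! (j - length u) = b" by (intro R[rule_format]) auto
      then show "(u @ w) ! j = b" using j by (simp add: nth_append)
    qed
  qed
  moreover have "(u @ w) ! (length u + i - 1) = w ! (i - 1)"
    using assms nth_append_length_plus[of u w "i - 1"] by simp
  moreover have "(u @ w) ! (length u + i + k) = w ! (i + k)"
    by (simp add: nth_append)
  ultimately show ?thesis using assms unfolding is_run_def by auto
qed

text \<open>This covers runs of ones at the very start of \<open>w\<close>, which
  \<open>is_run_append\<close> excludes: a prepended 0 does not extend them.\<close>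

lemma is_run_True_Cons_False:
  assumes "is_run True (False # w) i k"
  shows "0 < i \<and> is_run True w (i - 1) k"
proof -
  note r = is_runD[OF assms]
  have i: "0 < i" using r(1) r(3)[of i] by (cases i) auto
  then obtain i' where i': "i = Suc i'" by (cases i) auto
  have "w ! j" if "i' \<le> j" "j < i' + k" for j
    using r(3)[of "Suc j"] that i' by simp
  then have "is_run True w i' k"
    using r(1,2,4,5) i' unfolding is_run_def by (cases i') auto
  then show ?thesis using i' by simp
qed

lemma run_constrained_Cons_False:
  assumes "run_constrained w"
  shows "run_constrained (False # w)"
  unfolding run_constrained_def
proof (intro allI impI)
  fix i k assume "is_run True (False # w) i k"
  then have i: "0 < i" and r: "is_run True w (i - 1) k"
    using is_run_True_Cons_False by blast+
  obtain m where "m > k" "is_run False w (i - 1 + k) m"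
    using assms r unfolding run_constrained_def by blast
  \<comment> \<open>Even if \<open>i - 1 = 0\<close>, the zeros start at \<open>i - 1 + k\<close>,
    which is positive because \<open>k\<close> is.\<close>
  then show "\<exists>m>k. is_run False (False # w) (i + k) m"
    using is_run_append[of "i - 1 + k" False "[False]" w m] is_runD(1)[OF r] i by auto
qed

lemma run_constrained_replicate_False:
  "run_constrained w \<Longrightarrow> run_constrained (replicate a False @ w)"
  by (induction a) (auto intro: run_constrained_Cons_False)

lemma run_constrained_Nil: "run_constrained []"
  by (simp add: run_constrained_def is_run_def)

text \<open>The run may continue into \<open>w\<close>, so \<open>b\<close> only bounds its length
  from below; \<open>takeWhile\<close> measures the full run.\<close>

lemma ex_is_run_False_replicate:
  assumes "0 < b"
  shows "\<exists>m\<ge>b. is_run False (replicate b False @ w) 0 m"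
proof -
  let ?x = "replicate b False @ w"
  define m where "m = length (takeWhile Not ?x)"
  have le: "m \<le> length ?x" unfolding m_def by (rule length_takeWhile_le)
  have "b \<le> m" by (simp add: m_def takeWhile_append)
  moreover have "\<not> ?x ! j" if "j < m" for j
    using that takeWhile_nth[of j Not ?x] nth_mem[of j "takeWhile Not ?x"]
    unfolding m_def by (metis set_takeWhileD)
  moreover have "m = length ?x \<or> ?x ! m"
    using le nth_length_takeWhile[of Not ?x] unfolding m_def by linarith
  ultimately show ?thesis using assms le unfolding is_run_def by auto
qed

text \<open>The only new run of ones is the prepended block, which at least \<open>b > a\<close>
  zeros follow. Every other run lies beyond position \<open>a\<close> and is inherited from the
  suffix.\<close>

lemma run_constrained_replicate_True:
  assumes rc: "run_constrained (replicate b False @ w)" and ab: "a < b"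
  shows "run_constrained (replicate a True @ replicate b False @ w)"
  unfolding run_constrained_def
proof (intro allI impI)
  let ?x = "replicate b False @ w" and ?u = "replicate a True"
  fix i k assume run: "is_run True (?u @ ?x) i k"
  note r = is_runD[OF run]
  have x0: "\<not> (?u @ ?x) ! a" using ab by (simp add: nth_append)
  \<comment> \<open>Position \<open>a\<close> holds a 0, so a later run starts strictly inside the
    suffix, as \<open>is_run_append\<close> requires.\<close>
  have ia: "i \<noteq> a" using r(1) r(3)[of i] x0 by auto
  show "\<exists>m>k. is_run False (?u @ ?x) (i + k) m"
  proof (cases "i < a")
    case True
    have i0: "i = 0" using r(4) True by (cases i) (simp_all add: nth_append)
    have "k \<le> a" using r(3)[of a] x0 i0 by (cases "k \<le> a") simp_all
    moreover have "\<not> k < a" using r(2,5) i0 by (auto simp: nth_append)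
    ultimately have k: "k = a" by simp
    obtain m where m: "m \<ge> b" "is_run False ?x 0 m"
      using ex_is_run_False_replicate[OF le_less_trans[OF le0 ab], of w] by blast
    note s = is_runD[OF m(2)]
    have "is_run False (?u @ ?x) a m"
      unfolding is_run_def
    proof (intro conjI allI impI)
      fix j assume j: "a \<le> j \<and> j < a + m"
      then have "?x ! (j - a) = False" by (intro s(3)) auto
      then show "(?u @ ?x) ! j = False" using j by (simp add: nth_append[of ?u])
    next
      show "a = 0 \<or> (?u @ ?x) ! (a - 1) \<noteq> False"
        using True by (simp add: nth_append[of ?u])
    next
      show "a + m = length (?u @ ?x) \<or> (?u @ ?x) ! (a + m) \<noteq> False"
        using s(5) by (simp add: nth_append[of ?u])
    qed (use s(1,2) in simp_all)
    then show ?thesis using m(1) ab i0 k by (intro exI[of _ m]) simp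
  next
    case False
    then obtain i' where i': "i = length ?u + i'" "0 < i'"
      using ia that[of "i - a"] by simp
    then have "is_run True ?x i' k" using run is_run_append[of i' True ?u ?x k] by simp
    then obtain m where "m > k" "is_run False ?x (i' + k) m"
      using rc unfolding run_constrained_def by blast
    then show ?thesis
      using i' is_run_append[of "i' + k" False ?u ?x m] by (metis add.assoc add_gr_0)
  qed
qed

section \<open>The two complementary strings\<close>

text \<open>Here \<open>d\<close> counts the full blocks still to come, \<open>j\<close> and
  \<open>b\<close> are the length and bit of the next one, and \<open>r\<close> is the length of the
  remainder. The base clause serves both strings: for false \<open>b\<close> it is all
  zeros.\<close>

fun zigzag :: "nat \<Rightarrow> nat \<Rightarrow> nat \<Rightarrow> bool \<Rightarrow> bool list" where
  "zigzag 0 j r b = replicate (r - r div 2) b @ replicate (r div 2) False"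
| "zigzag (Suc d) j r b = replicate j b @ zigzag d (Suc j) r (\<not> b)"

lemma length_zigzag: "length (zigzag d j r b) = (\<Sum>i<d. j + i) + r"
  by (induction d j r b rule: zigzag.induct) (simp_all add: sum.lessThan_Suc_shift del: sum.lessThan_Suc)

lemma replicate_2: "[x, x] = replicate 2 x"
  by (simp add: numeral_2_eq_2)

text \<open>The sum \<open>j + d\<close> is invariant under the recursion. The bound matters at
  \<open>d = 0\<close>, where the \<open>r\<close> zeros and the appended 00 must supply
  \<open>j\<close> zeros.\<close>

lemma zigzag_False_prefix:
  assumes "j + d \<le> r + 2"
  shows "\<exists>w. zigzag d j r False @ [False, False] = replicate j False @ w"
proof (cases d)
  case 0
  have "zigzag d j r False @ [False, False] = replicate (r + 2) False"
  proof -
    have "r - r div 2 + r div 2 = r" by simp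
    then show ?thesis using 0 by (simp only: zigzag.simps replicate_2 replicate_add[symmetric])
  qed
  also have "\<dots> = replicate j False @ replicate (r + 2 - j) False"
    using assms by (simp flip: replicate_add)
  finally show ?thesis by blast
qed simp

text \<open>A block of \<open>j\<close> ones always meets at least \<open>j + 1\<close> zeros. In
  the remainder, the appended 00 makes the zeros outnumber the at most one more ones.\<close>

lemma run_constrained_zigzag:
  "j + d \<le> r + 2 \<Longrightarrow> run_constrained (zigzag d j r b @ [False, False])"
proof (induction d j r b rule: zigzag.induct)
  case (1 j r b)
  have eq: "zigzag 0 j r b @ [False, False] =
      replicate (r - r div 2) b @ replicate (r div 2 + 2) False @ []"
    by (simp only: zigzag.simps append_assoc replicate_2 replicate_add append_Nil2)
  have rc: "run_constrained (replicate (r div 2 + 2) False @ [])"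
    by (intro run_constrained_replicate_False run_constrained_Nil)
  show ?case
    unfolding eq using run_constrained_replicate_True[OF rc, of "r - r div 2"]
      run_constrained_replicate_False[OF rc, of "r - r div 2"]
    by (cases b) auto
next
  case (2 d j r b)
  then have IH: "run_constrained (zigzag d (Suc j) r (\<not> b) @ [False, False])" by simp
  show ?case
  proof (cases b)
    case True
    obtain w where "zigzag d (Suc j) r False @ [False, False] = replicate (Suc j) False @ w"
      using zigzag_False_prefix[of "Suc j" d r] 2(2) by auto
    then show ?thesis using IH True run_constrained_replicate_True[of "Suc j" w j] by simp
  next
    case False
    then show ?thesis using IH run_constrained_replicate_False by simp
  qed
qed

section \<open>Hamming distance as a lower bound for graph distance\<close>

definition hamming :: "'a list \<Rightarrow> 'a list \<Rightarrow> nat" where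
  "hamming u v = card {i. i < length u \<and> u ! i \<noteq> v ! i}"

lemma hamming_conv_zip:
  assumes "length u = length v"
  shows "hamming u v = length (filter (\<lambda>(x, y). x \<noteq> y) (zip u v))"
proof -
  have "{i. i < length u \<and> u ! i \<noteq> v ! i} =
      {i. i < length (zip u v) \<and> (\<lambda>(x, y). x \<noteq> y) (zip u v ! i)}"
    using assms by auto
  then show ?thesis by (simp only: hamming_def length_filter_conv_card)
qed

lemma hamming_append:
  assumes "length u = length v" "length u' = length v'"
  shows "hamming (u @ u') (v @ v') = hamming u v + hamming u' v'"
  using assms by (simp add: hamming_conv_zip)

lemma hamming_same [simp]: "hamming u u = 0"
  by (simp add: hamming_def)

lemma hamming_replicate: "x \<noteq> y \<Longrightarrow> hamming (replicate m x) (replicate m y) = m"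
  by (simp add: hamming_conv_zip zip_replicate)

lemma hamming_zigzag:
  "hamming (zigzag d j r b) (zigzag d j r (\<not> b)) = length (zigzag d j r b) - r div 2"
proof (induction d j r b rule: zigzag.induct)
  case (1 j r b)
  then show ?case by (simp add: hamming_append hamming_replicate)
next
  case (2 d j r b)
  \<comment> \<open>This keeps the truncated subtraction of \<open>r div 2\<close> exact when
    \<open>j\<close> is added.\<close>
  have "length (zigzag d (Suc j) r (\<not> b)) \<ge> r div 2" by (simp add: length_zigzag)
  then show ?case using 2 by (simp add: hamming_append hamming_replicate length_zigzag)
qed

text \<open>Each arc flips a single coordinate \<open>i\<close>, so dropping the first arc of a walk
  removes at most \<open>i\<close> from the set of differing positions.\<close>

lemma hamming_le_awalk_length:
  assumes "pre_digraph.awalk (fib_run_graph n) u p v"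
  shows "hamming u v \<le> length p"
proof -
  interpret graph "fib_run_graph n" by (rule graph_fib_run_graph)
  show ?thesis using assms
  proof (induction p arbitrary: u)
    case Nil
    then show ?case by (simp add: awalk_Nil_iff)
  next
    case (Cons e p)
    have ends: "tail (fib_run_graph n) = fst" "head (fib_run_graph n) = snd"
      by (simp_all add: fib_run_graph_def)
    have e: "e \<in> arcs (fib_run_graph n)" "u = fst e" and w: "awalk (snd e) p v"
      using Cons.prems unfolding awalk_Cons_iff ends by simp_all
    let ?u' = "snd e"
    have len: "length u = n" "length ?u' = n" and "\<exists>!i. i < n \<and> u ! i \<noteq> ?u' ! i"
      using e by (auto simp: fib_run_graph_def fib_run_verts_def)
    then obtain i where i: "\<And>j. j < n \<Longrightarrow> u ! j \<noteq> ?u' ! j \<Longrightarrow> j = i" by blast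
    have "{j. j < n \<and> u ! j \<noteq> v ! j} \<subseteq> insert i {j. j < n \<and> ?u' ! j \<noteq> v ! j}"
      using i by auto
    then have "hamming u v \<le> card (insert i {j. j < n \<and> ?u' ! j \<noteq> v ! j})"
      unfolding hamming_def len by (intro card_mono) auto
    also have "\<dots> \<le> Suc (hamming ?u' v)"
      unfolding hamming_def len by (simp add: card_insert_if)
    also have "\<dots> \<le> length (e # p)" using Cons.IH[OF w] by simp
    finally show ?case .
  qed
qed

lemma hamming_le_graph_dist: "ereal (real (hamming u v)) \<le> graph_dist (fib_run_graph n) u v"
proof -
  interpret graph "fib_run_graph n" by (rule graph_fib_run_graph)
  show ?thesis
    unfolding graph_dist_def \<mu>_def
    using hamming_le_awalk_length
    by (intro INF_greatest) (auto simp: awalk_cost_def sum_list_triv)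
qed

section \<open>Choice of parameters and the final estimate\<close>

text \<open>Increase \<open>r\<close> until it reaches \<open>2 * k\<close>. The next number is
  k(k+1)/2 + 2k + 1 = (k+1)(k+2)/2 + k, so the pair becomes (k+1, k), where the lower bound on the
  remainder is tight.\<close>

lemma triangular_decomposition:
  fixes n :: nat
  assumes "n \<ge> 1"
  shows "\<exists>k r. n = (\<Sum>i<k. 1 + i) + r \<and> k \<le> r + 1 \<and> r \<le> 2 * k"
  using assms
proof (induction n rule: dec_induct)
  case base
  show ?case by (intro exI[of _ "1::nat"] exI[of _ "0::nat"]) simp
next
  case (step n)
  then obtain k r where kr: "n = (\<Sum>i<k. 1 + i) + r" "k \<le> r + 1" "r \<le> 2 * k" by blast
  show ?case
  proof (cases "r < 2 * k")
    case True
    then show ?thesis using kr by (intro exI[of _ k] exI[of _ "Suc r"]) simp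
  next
    case False
    then show ?thesis using kr by (intro exI[of _ "Suc k"] exI[of _ k]) simp
  qed
qed

theorem theorem5p3:
  fixes n :: nat
  assumes "n \<ge> 1"
  shows "diam (fib_run_graph n) > ereal (real n - sqrt (2 * real n))"
proof -
  obtain k r where kr: "n = (\<Sum>i<k. 1 + i) + r" "k \<le> r + 1" "r \<le> 2 * k"
    using triangular_decomposition[OF assms] by blast
  let ?u = "zigzag k 1 r True" and ?v = "zigzag k 1 r False"
  have V: "zigzag k 1 r b \<in> fib_run_verts n" for b
    using run_constrained_zigzag[of 1 k r b] kr by (simp add: fib_run_verts_def length_zigzag)
  have h: "hamming ?u ?v = n - r div 2"
    using hamming_zigzag[of k 1 r True] kr(1) by (simp add: length_zigzag)
  have "2 * (\<Sum>i<m. 1 + i) = m * m + m" for m :: nat by (induction m) auto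
  then have n2: "2 * n = k * k + k + 2 * r" using kr(1) by (metis distrib_left)
  have "(r div 2) * (r div 2) \<le> k * k" using kr(3) by (intro mult_mono) auto
  \<comment> \<open>This is the excess of \<open>2 * n\<close> over \<open>k * k\<close>, which
    makes the final inequality strict.\<close>
  moreover have "0 < k + 2 * r" using n2 assms by (cases "k = 0") auto
  ultimately have "(r div 2)\<^sup>2 < 2 * n" using n2 unfolding power2_eq_square by linarith
  then have "(real (r div 2))\<^sup>2 < 2 * real n"
    by (metis of_nat_less_iff of_nat_mult of_nat_numeral of_nat_power)
  then have "real (r div 2) < sqrt (2 * real n)" by (rule real_less_rsqrt)
  moreover have "real (hamming ?u ?v) = real n - real (r div 2)"
    using h kr(1) by (simp add: of_nat_diff)
  ultimately have "ereal (real n - sqrt (2 * real n)) < ereal (real (hamming ?u ?v))" by simp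
  also have "\<dots> \<le> graph_dist (fib_run_graph n) ?u ?v" by (rule hamming_le_graph_dist)
  also have "\<dots> \<le> diam (fib_run_graph n)"
    unfolding diam_def using V
    by (intro SUP_upper2[of "(?u, ?v)"]) (auto simp: fib_run_graph_def)
  finally show ?thesis .
qed

end
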